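(* Assume that the birth sequence $\boldsymbol b=(b_1,\dots,b_n)$ and the death sequence $\boldsymbol d=(d_1,\dots,d_n)$ satisfy $\boldsymbol b<\boldsymbol d$, that is, $b_1<\dots<b_n$, $d_1<\dots<d_n$ and $b_n<d_1$. Then there exists a bijective correspondence $$\mathcal K(\boldsymbol b,\boldsymbol d)\;\cong\;\mathrm{GL}_n(\mathbb C)/B\;\cong\;\mathcal F_n.$$
   Context: $\mathbb C[z]$ is the polynomial ring in one variable, graded by $\deg z=1$. All modules are non-negatively graded $\mathbb C[z]$-modules, submodules are graded submodules, and isomorphisms of modules preserve degree. Let $n\ge 1$, and let the entries $b_i,d_i$ of $\boldsymbol b$ and $\boldsymbol d$ be non-negative integers. For an integer $b\ge 0$, $z^b\mathbb C[z]$ denotes the graded free module of rank one generated in degree $b$. Let $F=\bigoplus_{i=1}^n\mathbb C[z]$ be the ambient free module, and fix a graded free module $F_0\cong\bigoplus_{i=1}^n z^{b_i}\mathbb C[z]$, regarded as a submodule of $F$. The set $\mathcal K(\boldsymbol b,\boldsymbol d)$ is the collection of submodules of $F_0$ given by $$\mathcal K(\boldsymbol b,\boldsymbol d)=\Bigl\{K\subseteq F_0 : K\cong\bigoplus_{i=1}^n z^{d_i}\mathbb C[z]\Bigr\}.$$ $\mathrm{GL}_n(\mathbb C)$ is the general linear group, $B\subset\mathrm{GL}_n(\mathbb C)$ is the subgroup of upper triangular matrices, and $\mathrm{GL}_n(\mathbb C)/B$ is the set of cosets $AB$. A complete flag in $\mathbb C^n$ is a sequence of vector subspaces $\{0\}=V_0\subset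 V_1\subset\dots\subset V_n=\mathbb C^n$ with $\dim V_i=i$, and $\mathcal F_n$ is the set of all complete flags in $\mathbb C^n$ (the flag variety). *)

theory Defs
  imports
    "HOL-Analysis.Analysis"
    "HOL-Computational_Algebra.Polynomial"
    "HOL-Algebra.Left_Coset"
begin

text \<open>
  The index type \<open>'n\<close>, finite and linearly ordered, plays the role of \<open>{1 < ... < n}\<close> with
  \<open>n = CARD('n) \<ge> 1\<close>. The ambient graded module is \<open>(complex poly)^'n\<close>, the direct sum of
  \<open>n\<close> copies of the polynomial ring, each generated in degree 0.
\<close>

interpretation pvec: module "(*s) :: complex poly \<Rightarrow> complex poly^'n \<Rightarrow> complex poly^'n"
  by unfold_locales (vector algebra_simps)+

definition hom_component :: "nat \<Rightarrow> complex poly^'n \<Rightarrow> complex poly^'n" where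
  "hom_component k v = (\<chi> i. monom (coeff (v $ i) k) k)"

definition homogeneous :: "nat \<Rightarrow> complex poly^'n \<Rightarrow> bool" where
  "homogeneous k v \<longleftrightarrow> hom_component k v = v"

text \<open>A submodule is graded iff it contains the homogeneous components of its elements.\<close>

definition graded_submodule :: "(complex poly^'n) set \<Rightarrow> bool" where
  "graded_submodule M \<longleftrightarrow> pvec.subspace M \<and> (\<forall>v\<in>M. \<forall>k. hom_component k v \<in> M)"

definition graded_iso :: "(complex poly^'n) set \<Rightarrow> (complex poly^'n) set \<Rightarrow> bool" where
  "graded_iso M N \<longleftrightarrow> (\<exists>\<phi>. bij_betw \<phi> M N
     \<and> (\<forall>x\<in>M. \<forall>y\<in>M. \<phi> (x + y) = \<phi> x + \<phi> y)
     \<and> (\<forall>p. \<forall>x\<in>M. \<phi> (p *s x) = p *s \<phi> x)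
     \<and> (\<forall>k. \<forall>x\<in>M. homogeneous k x \<longrightarrow> homogeneous k (\<phi> x)))"

text \<open>
  The direct sum of the modules \<open>z^(a i) \<complex>[z]\<close>, realised inside the ambient module
  (with the ambient grading, so the \<open>i\<close>-th generator has degree \<open>a i\<close>).
\<close>

definition free_graded :: "('n \<Rightarrow> nat) \<Rightarrow> (complex poly^'n) set" where
  "free_graded a = {v. \<forall>i. monom 1 (a i) dvd v $ i}"

lemma graded_submodule_free_graded: "graded_submodule (free_graded a)"
proof -
  have "pvec.subspace (free_graded a)"
    unfolding pvec.subspace_def free_graded_def by auto
  then show ?thesis
    unfolding graded_submodule_def free_graded_def hom_component_def
    by (auto simp: monom_1_dvd_iff')
qed

definition K_set :: "(complex poly^'n) set \<Rightarrow> ('n \<Rightarrow> nat) \<Rightarrow> (complex poly^'n) set set" where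
  "K_set F0 d = {K. K \<subseteq> F0 \<and> graded_submodule K \<and> graded_iso K (free_graded d)}"

definition GL :: "(complex^'n^'n) monoid" where
  "GL = \<lparr>carrier = {A. invertible A}, mult = (**), one = mat 1\<rparr>"

lemma group_GL: "group (GL :: (complex^'n^'n) monoid)"
proof (rule groupI)
  fix A :: "complex^'n^'n" assume "A \<in> carrier GL"
  then show "\<exists>B\<in>carrier GL. B \<otimes>\<^bsub>GL\<^esub> A = \<one>\<^bsub>GL\<^esub>"
    unfolding GL_def invertible_def by auto
qed (auto simp: GL_def invertible_mult matrix_mul_assoc invertible_def[of "mat 1"])

definition Borel_subgroup :: "(complex^('n::{finite,linorder})^('n::{finite,linorder})) set" where
  "Borel_subgroup = {A \<in> carrier GL. \<forall>i j. j < i \<longrightarrow> A $ i $ j = 0}"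

text \<open>A complete flag \<open>V\<^sub>0 \<subset> ... \<subset> V\<^sub>n\<close> is encoded as the list of its \<open>n + 1\<close> members.\<close>

definition complete_flags :: "(complex^'n) set list set" where
  "complete_flags = {V. length V = CARD('n) + 1
     \<and> (\<forall>i\<le>CARD('n). vec.subspace (V ! i) \<and> vec.dim (V ! i) = i)
     \<and> (\<forall>i<CARD('n). V ! i \<subset> V ! Suc i)
     \<and> V ! 0 = {0} \<and> V ! CARD('n) = UNIV}"

end

theory Submission
  imports Defs
begin

text \<open>
  Both sets are orbits of \<open>GL\<close> whose base point has stabiliser the Borel subgroup, so each is in
  bijection with the left cosets (lemma \<open>orbit_lcosets_bij\<close>).

  A matrix of complex numbers acts on the ambient module coefficientwise. An isomorphism from
  \<open>free_graded a\<close> onto a graded submodule \<open>K\<close> sends the generator \<open>z^(a j) e\<^sub>j\<close> to a homogeneous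
  element of the same degree, hence to \<open>z^(a j)\<close> times a constant vector. Taking these constant
  vectors as columns gives a matrix \<open>A\<close>, invertible because the isomorphism is injective, with
  \<open>K = A \<cdot> free_graded a\<close> (lemma \<open>graded_iso_free_graded_iff\<close>). Applied to \<open>F0\<close>, this
  shows that \<open>F0\<close> contains every element of the ambient module all of whose terms have degree at
  least \<open>b\<^sub>n\<close>. As \<open>b\<^sub>n < d\<^sub>1\<close>, the condition \<open>K \<subseteq> F0\<close> then holds for every
  graded submodule isomorphic to \<open>free_graded d\<close>, and \<open>K_set F0 d\<close> is exactly the orbit of
  \<open>free_graded d\<close>. Since \<open>d\<close> is strictly increasing, a matrix maps \<open>free_graded d\<close> into itself iff
  it is upper triangular.

  The flags form the orbit of the standard flag of coordinate subspaces: a vector \<open>v\<^sub>i\<close> chosen in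
  \<open>V\<^sub>i - V\<^sub>i\<^sub>-\<^sub>1\<close> for each \<open>i\<close> gives the columns of a matrix carrying the standard flag to \<open>V\<close>.
\<close>

section \<open>Orbits and left cosets\<close>

text \<open>
  Here \<open>f a\<close> stands for \<open>a \<cdot> x\<^sub>0\<close>, where \<open>x\<^sub>0\<close> is the base point; the only trace of the action that
  is needed is that equality of values of \<open>f\<close> is preserved by left translation.
\<close>

lemma (in group) orbit_lcosets_bij:
  assumes equiv: "\<And>a b c. \<lbrakk>a \<in> carrier G; b \<in> carrier G; c \<in> carrier G; f a = f b\<rbrakk>
      \<Longrightarrow> f (c \<otimes> a) = f (c \<otimes> b)"
    and stab: "H = {a \<in> carrier G. f a = f \<one>}"
    and orbit: "f ` carrier G = X"
  shows "\<exists>g. bij_betw g (lcosets H) X"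
proof -
  have coset: "a <# H = {c \<in> carrier G. f c = f a}" if a: "a \<in> carrier G" for a
  proof (intro equalityI subsetI)
    fix c assume "c \<in> a <# H"
    then obtain h where h: "h \<in> carrier G" "f h = f \<one>" "c = a \<otimes> h"
      unfolding l_coset_def stab by auto
    with equiv[of h \<one> a] a show "c \<in> {c \<in> carrier G. f c = f a}" by simp
  next
    fix c assume c: "c \<in> {c \<in> carrier G. f c = f a}"
    then have "f (inv a \<otimes> c) = f (inv a \<otimes> a)" using a equiv by blast
    then have "inv a \<otimes> c \<in> H" using a c by (simp add: stab)
    moreover have "c = a \<otimes> (inv a \<otimes> c)" using a c by (simp add: m_assoc[symmetric])
    ultimately show "c \<in> a <# H" unfolding l_coset_def by blast
  qed
  define g where "g C = f (SOME c. c \<in> C)" for C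
  have g: "g (a <# H) = f a" if a: "a \<in> carrier G" for a
  proof -
    have "a \<in> a <# H" using a coset[OF a] by simp
    then have "(SOME c. c \<in> a <# H) \<in> a <# H" by (rule someI)
    then show ?thesis unfolding g_def using coset[OF a] by blast
  qed
  have "bij_betw g (lcosets H) X"
  proof (rule bij_betw_imageI)
    show "inj_on g (lcosets H)"
    proof (rule inj_onI)
      fix C D assume "C \<in> lcosets H" "D \<in> lcosets H" and eq: "g C = g D"
      then obtain a b where "a \<in> carrier G" "C = a <# H" "b \<in> carrier G" "D = b <# H"
        unfolding LCOSETS_def by blast
      with eq show "C = D" by (simp add: g) (simp add: coset)
    qed
    show "g ` (lcosets H) = X"
      unfolding LCOSETS_def orbit[symmetric] by (auto simp: g image_iff)
  qed
  then show ?thesis by blast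
qed

section \<open>The standard flag\<close>

text \<open>The \<open>i\<close>-th member of the standard flag, spanned by the first \<open>i\<close> unit vectors;
  \<open>card {..<j}\<close> is the position of the index \<open>j\<close>, counted from 0.\<close>

definition coord_subspace :: "nat \<Rightarrow> (complex^('n::{finite,linorder})) set" where
  "coord_subspace i = {x. \<forall>j. i \<le> card {..<j} \<longrightarrow> x $ j = 0}"

text \<open>The image of the standard flag under \<open>A\<close>; the list runs over \<open>i = 0, ..., n\<close>.\<close>

definition flag_of :: "complex^('n::{finite,linorder})^('n::{finite,linorder}) \<Rightarrow> (complex^('n::{finite,linorder})) set list" where
  "flag_of A = map (\<lambda>i. (*v) A ` coord_subspace i) [0..<CARD('n) + 1]"

lemma card_lessThan_strict_mono:
  "strict_mono (\<lambda>j::'n::{finite,linorder}. card {..<j})"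
  by (rule strict_monoI, rule psubset_card_mono) auto

lemma card_lessThan_less_CARD: "card {..<j::'n::{finite,linorder}} < CARD('n)"
  by (rule psubset_card_mono) auto

lemma card_lessThan_le_iff:
  "card {..<i} \<le> card {..<j} \<longleftrightarrow> i \<le> (j::'n::{finite,linorder})"
  using strict_mono_less_eq[OF card_lessThan_strict_mono] .

lemma card_card_lessThan_less:
  assumes "i \<le> CARD('n)"
  shows "card {j::'n::{finite,linorder}. card {..<j} < i} = i"
proof -
  let ?r = "\<lambda>j::'n. card {..<j}"
  have inj: "inj ?r" using strict_mono_imp_inj_on[OF card_lessThan_strict_mono] .
  have "range ?r = {..<CARD('n)}"
    by (rule card_subset_eq) (auto simp: card_lessThan_less_CARD card_image[OF inj])
  then have "?r ` {j. ?r j < i} = {..<i}"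
  proof (intro equalityI subsetI)
    fix k assume "k \<in> {..<i}"
    moreover from this have "k \<in> range ?r" using \<open>range ?r = _\<close> assms by simp
    ultimately show "k \<in> ?r ` {j. ?r j < i}" by blast
  qed blast
  then show ?thesis
    using card_image[OF inj_on_subset[OF inj subset_UNIV], of "{j. ?r j < i}"] by simp
qed

lemma subspace_coord_subspace: "vec.subspace (coord_subspace i)"
  unfolding vec.subspace_def coord_subspace_def by auto

lemma dim_coord_subspace:
  assumes "i \<le> CARD('n)"
  shows "vec.dim (coord_subspace i :: (complex^('n::{finite,linorder})) set) = i"
proof -
  have "coord_subspace i = {x::(complex, 'n) vec. \<forall>j. j \<notin> {j. card {..<j} < i} \<longrightarrow> x $ j = 0}"
    unfolding coord_subspace_def by auto
  then show ?thesis
    using dim_substandard_cart[of "{j::'n. card {..<j} < i}"] card_card_lessThan_less[OF assms]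
    by simp
qed

lemma coord_subspace_CARD:
  "coord_subspace CARD('n) = (UNIV :: (complex^('n::{finite,linorder})) set)"
  unfolding coord_subspace_def using card_lessThan_less_CARD by (auto simp: not_le[symmetric])

lemma coord_subspace_psubset:
  assumes "i < CARD('n)"
  shows "coord_subspace i \<subset> (coord_subspace (Suc i) :: (complex^('n::{finite,linorder})) set)"
proof -
  have "coord_subspace i \<noteq> (coord_subspace (Suc i) :: ((complex, 'n) vec) set)"
    using dim_coord_subspace[where 'n='n, of i] dim_coord_subspace[where 'n='n, of "Suc i"] assms
    by (metis Suc_leI less_imp_le n_not_Suc_n)
  then show ?thesis unfolding coord_subspace_def by auto
qed

lemma inj_matrix_vector_mult_GL: "A \<in> carrier GL \<Longrightarrow> inj ((*v) A)"
  unfolding GL_def by (simp add: inj_matrix_vector_mult)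

lemma matrix_vector_mult_axis: "(A *v axis j x) $ i = A $ i $ j * (x::'a::comm_semiring_1)"
  by (simp add: matrix_vector_mult_def axis_def if_distrib cong: if_cong)

text \<open>An upper triangular matrix plainly maps each coordinate subspace into itself; being
  invertible, it maps it onto itself by equality of dimensions.\<close>

lemma flag_of_eq_iff_upper_triangular:
  fixes A :: "complex^('n::{finite,linorder})^('n::{finite,linorder})"
  assumes A: "A \<in> carrier GL"
  shows "flag_of A = flag_of (mat 1) \<longleftrightarrow> (\<forall>i j. j < i \<longrightarrow> A $ i $ j = 0)"
proof
  assume "flag_of A = flag_of (mat 1)"
  then have eq: "(*v) A ` coord_subspace k = coord_subspace k" if "k \<le> CARD('n)" for k
    using that unfolding flag_of_def by (simp del: upt_Suc)
  show "\<forall>i j. j < i \<longrightarrow> A $ i $ j = 0"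
  proof (intro allI impI)
    fix i j :: 'n assume "j < i"
    then have less: "card {..<j} < card {..<i}" using card_lessThan_le_iff[of i j] by auto
    let ?k = "Suc (card {..<j})"
    have "axis j 1 \<in> coord_subspace ?k"
      unfolding coord_subspace_def by (auto simp: axis_def)
    then have "A *v axis j 1 \<in> coord_subspace ?k"
      using eq[of ?k] card_lessThan_less_CARD[of j] by (auto simp: Suc_le_eq)
    then show "A $ i $ j = 0"
      using less by (auto simp: coord_subspace_def matrix_vector_mult_axis Suc_le_eq)
  qed
next
  assume upper: "\<forall>i j. j < i \<longrightarrow> A $ i $ j = 0"
  have "(*v) A ` coord_subspace k = coord_subspace k" if k: "k \<le> CARD('n)" for k
  proof (rule vec.subspace_dim_equal)
    show "(*v) A ` coord_subspace k \<subseteq> coord_subspace k"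
    proof (clarsimp simp: coord_subspace_def)
      fix x :: "(complex, 'n) vec" and i :: 'n
      assume x: "\<forall>j. k \<le> card {..<j} \<longrightarrow> x $ j = 0" and i: "k \<le> card {..<i}"
      have "A $ i $ j * x $ j = 0" for j
      proof (cases "j < i")
        case False
        then have "k \<le> card {..<j}" using i card_lessThan_le_iff[of i j] by auto
        then show ?thesis using x by simp
      qed (use upper in simp)
      then show "(A *v x) $ i = 0"
        by (simp add: matrix_vector_mult_def sum.neutral del: mult_eq_0_iff)
    qed
    have "vec.dim ((*v) A ` coord_subspace k) = vec.dim (coord_subspace k :: ((complex, 'n) vec) set)"
      by (rule vec.dim_image_eq[OF matrix_vector_mul_linear_gen])
        (use inj_matrix_vector_mult_GL[OF A] inj_on_subset in blast)
    then show "vec.dim (coord_subspace k :: ((complex, 'n) vec) set) \<le> vec.dim ((*v) A ` coord_subspace k)"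
      by simp
  qed (auto intro!: subspace_coord_subspace vec.subspace_image matrix_vector_mul_linear_gen)
  then show "flag_of A = flag_of (mat 1)"
    unfolding flag_of_def by (simp del: upt_Suc)
qed

lemma flag_of_in_complete_flags:
  assumes A: "A \<in> carrier GL"
  shows "flag_of A \<in> (complete_flags :: (complex^('n::{finite,linorder})) set list set)"
proof -
  have nth: "flag_of A ! i = (*v) A ` coord_subspace i" if "i \<le> CARD('n)" for i
    using that unfolding flag_of_def by (subst nth_map) (auto simp del: upt_Suc)
  have inj: "inj ((*v) A)" by (rule inj_matrix_vector_mult_GL[OF A])
  have sub: "vec.subspace ((*v) A ` coord_subspace i)" for i
    by (intro vec.subspace_image subspace_coord_subspace)
  have dim: "vec.dim ((*v) A ` coord_subspace i) = i" if "i \<le> CARD('n)" for i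
    using vec.dim_image_eq[OF matrix_vector_mul_linear_gen, of A "coord_subspace i"]
      inj_on_subset[OF inj subset_UNIV] dim_coord_subspace[OF that] by simp
  have strict: "(*v) A ` coord_subspace i \<subset> (*v) A ` coord_subspace (Suc i)" if "i < CARD('n)" for i
    using coord_subspace_psubset[OF that] inj by (simp add: inj_image_subset_iff psubset_eq inj_image_eq_iff)
  have zero: "coord_subspace 0 = ({0} :: ((complex, 'n) vec) set)"
    unfolding coord_subspace_def by (auto simp: vec_eq_iff)
  have "surj ((*v) A)"
    using A unfolding GL_def by (simp add: matrix_right_invertible_surjective[symmetric] invertible_right_inverse)
  then show ?thesis
    unfolding complete_flags_def
    using nth sub dim strict zero coord_subspace_CARD[where 'n='n] by (auto simp: flag_of_def[of A])
qed

lemma complete_flag_is_flag_of: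
  fixes V :: "(complex^('n::{finite,linorder})) set list"
  assumes V: "V \<in> complete_flags"
  shows "\<exists>A \<in> carrier GL. V = flag_of A"
proof -
  let ?r = "\<lambda>j::'n. card {..<j}"
  have len: "length V = CARD('n) + 1"
    and sub: "\<And>i. i \<le> CARD('n) \<Longrightarrow> vec.subspace (V ! i)"
    and dim: "\<And>i. i \<le> CARD('n) \<Longrightarrow> vec.dim (V ! i) = i"
    and strict: "\<And>i. i < CARD('n) \<Longrightarrow> V ! i \<subset> V ! Suc i"
    using V unfolding complete_flags_def by auto
  have mono: "V ! i \<subseteq> V ! k" if "i \<le> k" "k \<le> CARD('n)" for i k
    using that
  proof (induction k rule: dec_induct)
    case (step k)
    then show ?case using strict[of k] by auto
  qed simp
  have "\<forall>j. \<exists>v. v \<in> V ! Suc (?r j) \<and> v \<notin> V ! ?r j"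
    using strict card_lessThan_less_CARD by blast
  then obtain v where v: "\<And>j. v j \<in> V ! Suc (?r j)" "\<And>j. v j \<notin> V ! ?r j"
    by metis
  define A :: "((complex, 'n) vec, 'n) vec" where "A = (\<chi> i j. v j $ i)"
  have A_mult: "A *v x = (\<Sum>j\<in>UNIV. x $ j *s v j)" for x
    by (simp add: A_def vec_eq_iff matrix_vector_mult_def mult.commute)
  have "x = 0" if x: "A *v x = 0" for x
  proof (rule ccontr)
    assume "x \<noteq> 0"
    then have ne: "{j. x $ j \<noteq> 0} \<noteq> {}" by (auto simp: vec_eq_iff)
    define m where "m = Max {j. x $ j \<noteq> 0}"
    have m: "x $ m \<noteq> 0" using Max_in[OF _ ne] by (simp add: m_def)
    have above: "x $ j = 0" if "j > m" for j
    proof (rule ccontr)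
      assume "x $ j \<noteq> 0"
      then have "j \<le> m" unfolding m_def by (intro Max_ge) auto
      then show False using that by simp
    qed
    have subm: "vec.subspace (V ! ?r m)" using sub card_lessThan_less_CARD[of m] by simp
    \<comment> \<open>The last nonzero coefficient would express \<open>v m\<close> through earlier columns.\<close>
    have "x $ j *s v j \<in> V ! ?r m" if "j \<noteq> m" for j
    proof (cases "j < m")
      case True
      then have "?r j < ?r m" using card_lessThan_le_iff[of m j] by auto
      then have "V ! Suc (?r j) \<subseteq> V ! ?r m"
        using mono card_lessThan_less_CARD[of m] by simp
      then show ?thesis using v(1)[of j] vec.subspace_scale[OF subm] by auto
    next
      case False
      then show ?thesis using above that vec.subspace_0[OF subm] by auto
    qed
    then have "(\<Sum>j\<in>UNIV - {m}. x $ j *s v j) \<in> V ! ?r m"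
      by (intro vec.subspace_sum[OF subm]) auto
    moreover have "x $ m *s v m = - (\<Sum>j\<in>UNIV - {m}. x $ j *s v j)"
      using x unfolding A_mult by (subst (asm) sum.remove[of _ m]) (auto simp: eq_neg_iff_add_eq_0)
    ultimately have "x $ m *s v m \<in> V ! ?r m"
      using vec.subspace_neg[OF subm] by simp
    then have "inverse (x $ m) *s (x $ m *s v m) \<in> V ! ?r m"
      using vec.subspace_scale[OF subm] by blast
    then show False using m v(2)[of m] by simp
  qed
  then have inv: "invertible A"
    using matrix_left_invertible_ker[of A] invertible_left_inverse[of A] by blast
  then have GL: "A \<in> carrier GL" by (simp add: GL_def)
  have "V ! i = (*v) A ` coord_subspace i" if i: "i \<le> CARD('n)" for i
  proof (rule sym, rule vec.subspace_dim_equal)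
    show "(*v) A ` coord_subspace i \<subseteq> V ! i"
    proof safe
      fix x :: "(complex, 'n) vec" assume x: "x \<in> coord_subspace i"
      have "x $ j *s v j \<in> V ! i" for j
      proof (cases "?r j < i")
        case True
        then have "V ! Suc (?r j) \<subseteq> V ! i" using mono i by simp
        then show ?thesis using v(1)[of j] vec.subspace_scale[OF sub[OF i]] by auto
      next
        case False
        then show ?thesis using x vec.subspace_0[OF sub[OF i]] by (auto simp: coord_subspace_def)
      qed
      then show "A *v x \<in> V ! i"
        unfolding A_mult by (intro vec.subspace_sum[OF sub[OF i]]) auto
    qed
    show "vec.dim (V ! i) \<le> vec.dim ((*v) A ` coord_subspace i)"
      using vec.dim_image_eq[OF matrix_vector_mul_linear_gen, of A "coord_subspace i"]
        inj_on_subset[OF inj_matrix_vector_mult_GL[OF GL] subset_UNIV]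
        dim_coord_subspace[OF i] dim[OF i] by simp
  qed (use sub i in \<open>auto intro!: subspace_coord_subspace vec.subspace_image matrix_vector_mul_linear_gen\<close>)
  then have "V = flag_of A"
    unfolding flag_of_def by (intro nth_equalityI) (auto simp: len less_Suc_eq_le simp del: upt_Suc)
  with GL show ?thesis by blast
qed

section \<open>Constant matrices acting on the ambient module\<close>

text \<open>A matrix of complex numbers, seen as a matrix of constant polynomials.\<close>

definition const_matrix :: "complex^'n^'m \<Rightarrow> complex poly^'n^'m" where
  "const_matrix A = (\<chi> i j. [:A $ i $ j:])"

lemma sum_const_poly: "(\<Sum>i\<in>I. [:f i:]) = [:\<Sum>i\<in>I. f i:]"
  by (induction I rule: infinite_finite_induct) auto

lemma const_matrix_mult: "const_matrix (A ** B) = const_matrix A ** const_matrix B"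
  by (simp add: const_matrix_def matrix_matrix_mult_def vec_eq_iff sum_const_poly mult.commute)

lemma const_matrix_mat_1: "const_matrix (mat 1) = mat 1"
  by (simp add: const_matrix_def mat_def vec_eq_iff one_pCons)

lemma const_matrix_mult_component:
  "(const_matrix A *v v) $ i = (\<Sum>j\<in>UNIV. smult (A $ i $ j) (v $ j))"
  by (simp add: const_matrix_def matrix_vector_mult_def)

lemma matrix_vector_mult_smult:
  fixes A :: "'a::comm_semiring_1^'n^'m"
  shows "A *v (c *s x) = c *s (A *v x)"
  by (simp add: vec_eq_iff matrix_vector_mult_def sum_distrib_left mult_ac)

lemma matrix_vector_mult_sum: "A *v (\<Sum>i\<in>I. f i) = (\<Sum>i\<in>I. A *v f i)"
  by (induction I rule: infinite_finite_induct) (auto simp: matrix_vector_right_distrib)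

lemma hom_component_const_matrix:
  "hom_component k (const_matrix A *v v) = const_matrix A *v hom_component k v"
  by (simp add: vec_eq_iff hom_component_def const_matrix_mult_component coeff_sum
      smult_monom monom_sum)

lemma const_matrix_mult_inverse:
  assumes "A ** B = mat 1"
  shows "const_matrix A *v (const_matrix B *v v) = v"
  by (simp add: matrix_vector_mul_assoc const_matrix_mult[symmetric] assms const_matrix_mat_1)

section \<open>Graded free submodules\<close>

lemma hom_component_sum: "hom_component k (\<Sum>i\<in>I. f i) = (\<Sum>i\<in>I. hom_component k (f i))"
  by (simp add: hom_component_def vec_eq_iff coeff_sum monom_sum)

lemma hom_component_hom_component:
  "hom_component k (hom_component m v) = (if k = m then hom_component m v else 0)"
  by (auto simp: hom_component_def vec_eq_iff)

lemma homogeneous_hom_component: "homogeneous k (hom_component k v)"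
  by (simp add: homogeneous_def hom_component_hom_component)

lemma sum_hom_components: "\<exists>N. v = (\<Sum>m\<le>N. hom_component m v)"
proof -
  define N where "N = Max (range (\<lambda>i. degree (v $ i)))"
  have "degree (v $ i) \<le> N" for i unfolding N_def by (rule Max_ge) auto
  then have "v $ i = (\<Sum>m\<le>N. monom (coeff (v $ i) m) m)" for i
    using poly_as_sum_of_monoms'[of "v $ i" N] by simp
  then have "v = (\<Sum>m\<le>N. hom_component m v)"
    by (simp add: vec_eq_iff hom_component_def)
  then show ?thesis by blast
qed

text \<open>A graded isomorphism is linear only on the module it starts from, so the values of \<open>\<phi>\<close>
  off \<open>M\<close> must not enter.\<close>

lemma additive_on_sum:
  assumes M: "pvec.subspace M" and add: "\<forall>x\<in>M. \<forall>y\<in>M. \<phi> (x + y) = \<phi> x + (\<phi> y :: complex poly^'n)"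
    and scale: "\<forall>p. \<forall>x\<in>M. \<phi> (p *s x) = p *s \<phi> x"
    and f: "\<And>i. i \<in> I \<Longrightarrow> f i \<in> M" and I: "finite I"
  shows "\<phi> (\<Sum>i\<in>I. f i) = (\<Sum>i\<in>I. \<phi> (f i))"
  using I f
proof (induction I)
  case empty
  then show ?case using scale[rule_format, of 0 0] pvec.subspace_0[OF M] by auto
next
  case (insert i I)
  have "(\<Sum>i\<in>I. f i) \<in> M" using insert.prems by (intro pvec.subspace_sum[OF M]) auto
  then show ?case using insert add by simp
qed

text \<open>The definition of a graded isomorphism asks only that the map preserves homogeneity; its
  inverse then does too.\<close>

lemma graded_iso_sym:
  assumes "graded_submodule M" and "graded_iso M N"
  shows "graded_iso N M"
proof -
  have M: "pvec.subspace M" and comp: "\<And>v k. v \<in> M \<Longrightarrow> hom_component k v \<in> M"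
    using assms(1) unfolding graded_submodule_def by auto
  obtain \<phi> where bij: "bij_betw \<phi> M N"
    and add: "\<forall>x\<in>M. \<forall>y\<in>M. \<phi> (x + y) = \<phi> x + \<phi> y"
    and scale: "\<forall>p. \<forall>x\<in>M. \<phi> (p *s x) = p *s \<phi> x"
    and hom: "\<forall>k. \<forall>x\<in>M. homogeneous k x \<longrightarrow> homogeneous k (\<phi> x)"
    using assms(2) unfolding graded_iso_def by blast
  have inj: "inj_on \<phi> M" and im: "\<phi> ` M = N" using bij by (auto simp: bij_betw_def)
  have reflect: "homogeneous k x" if x: "x \<in> M" and k: "homogeneous k (\<phi> x)" for x k
  proof -
    obtain N where N: "x = (\<Sum>m\<le>N. hom_component m x)" using sum_hom_components by blast
    have zero: "\<phi> 0 = 0" using scale[rule_format, of 0 0] pvec.subspace_0[OF M] by simp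
    have homc: "hom_component m (\<phi> (hom_component m x)) = \<phi> (hom_component m x)" for m
      using hom comp[OF x] homogeneous_hom_component unfolding homogeneous_def by blast
    have "\<phi> x = (\<Sum>m\<le>N. \<phi> (hom_component m x))"
      using additive_on_sum[OF M add scale, of "{..N}" "\<lambda>m. hom_component m x"] comp[OF x]
      by (simp add: N[symmetric])
    then have "hom_component k (\<phi> x)
        = (\<Sum>m\<le>N. hom_component k (hom_component m (\<phi> (hom_component m x))))"
      by (simp add: hom_component_sum homc)
    also have "\<dots> = (\<Sum>m\<le>N. if m = k then \<phi> (hom_component k x) else 0)"
      by (rule sum.cong[OF refl], subst hom_component_hom_component) (simp add: homc)
    also have "\<dots> = \<phi> (if k \<le> N then hom_component k x else 0)" by (simp add: zero)
    finally have "\<phi> x = \<phi> (if k \<le> N then hom_component k x else 0)"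
      using k by (simp add: homogeneous_def)
    then have "x = (if k \<le> N then hom_component k x else 0)"
      using inj x comp[OF x] pvec.subspace_0[OF M] by (auto dest!: inj_onD)
    moreover have "homogeneous k 0"
      by (simp add: homogeneous_def hom_component_def vec_eq_iff)
    ultimately show ?thesis
      using homogeneous_hom_component[of k x] by (metis (full_types))
  qed
  let ?\<psi> = "inv_into M \<phi>"
  have \<psi>: "?\<psi> (\<phi> x) = x" if "x \<in> M" for x using inj that by simp
  show ?thesis
    unfolding graded_iso_def
  proof (intro exI[of _ ?\<psi>] conjI ballI allI impI)
    show "bij_betw ?\<psi> N M" using bij by (rule bij_betw_inv_into)
    fix x y k p assume "x \<in> N"
    then obtain u where u: "u \<in> M" "x = \<phi> u" using im by blast
    show "?\<psi> (p *s x) = p *s ?\<psi> x"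
      using u scale \<psi> pvec.subspace_scale[OF M u(1)] by (metis (no_types))
    show "homogeneous k (?\<psi> x)" if "homogeneous k x" using that u \<psi> reflect by simp
    assume "y \<in> N"
    then obtain w where w: "w \<in> M" "y = \<phi> w" using im by blast
    show "?\<psi> (x + y) = ?\<psi> x + ?\<psi> y"
      using u w add \<psi> pvec.subspace_add[OF M u(1) w(1)] by (metis (no_types))
  qed
qed

lemma axis_monom_in_free_graded: "axis j (monom 1 (a j)) \<in> free_graded a"
  by (auto simp: free_graded_def axis_def)

lemma free_graded_as_sum:
  assumes "v \<in> free_graded a"
  shows "\<exists>p. v = (\<Sum>j\<in>UNIV. p j *s axis j (monom 1 (a j)))"
proof -
  have "\<forall>j. \<exists>q. v $ j = monom 1 (a j) * q" using assms by (auto simp: free_graded_def dvd_def)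
  then obtain p where p: "\<And>j. v $ j = monom 1 (a j) * p j" by metis
  have "v = (\<Sum>j\<in>UNIV. p j *s axis j (monom 1 (a j)))"
    by (simp add: vec_eq_iff axis_def p if_distrib mult.commute cong: if_cong)
  then show ?thesis by blast
qed

text \<open>The \<open>j\<close>-th column consists of the degree \<open>a j\<close> coefficients of the image of the
  \<open>j\<close>-th generator, which is homogeneous of that degree.\<close>

lemma graded_iso_free_graded_imp:
  assumes K: "graded_submodule K" and iso: "graded_iso K (free_graded a)"
  shows "\<exists>A \<in> carrier GL. K = (*v) (const_matrix A) ` free_graded a"
proof -
  have M: "pvec.subspace (free_graded a)"
    using graded_submodule_free_graded unfolding graded_submodule_def by blast
  obtain \<phi> where bij: "bij_betw \<phi> (free_graded a) K"
    and add: "\<forall>x\<in>free_graded a. \<forall>y\<in>free_graded a. \<phi> (x + y) = \<phi> x + \<phi> y"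
    and scale: "\<forall>p. \<forall>x\<in>free_graded a. \<phi> (p *s x) = p *s \<phi> x"
    and hom: "\<forall>k. \<forall>x\<in>free_graded a. homogeneous k x \<longrightarrow> homogeneous k (\<phi> x)"
    using graded_iso_sym[OF K iso] unfolding graded_iso_def by blast
  let ?e = "\<lambda>j. axis j (monom 1 (a j)) :: complex poly^'a"
  define A where "A = (\<chi> i j. coeff (\<phi> (?e j) $ i) (a j))"
  have gen: "\<phi> (?e j) = const_matrix A *v ?e j" for j
  proof -
    have "homogeneous (a j) (?e j)"
      by (auto simp: homogeneous_def hom_component_def vec_eq_iff axis_def)
    then have "hom_component (a j) (\<phi> (?e j)) = \<phi> (?e j)"
      using hom axis_monom_in_free_graded unfolding homogeneous_def by blast
    then have "\<phi> (?e j) $ i = monom (coeff (\<phi> (?e j) $ i) (a j)) (a j)" for i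
      by (metis hom_component_def vec_lambda_beta)
    then show ?thesis
      by (simp add: vec_eq_iff matrix_vector_mult_axis A_def const_matrix_def smult_monom)
  qed
  have \<phi>: "\<phi> v = const_matrix A *v v" if v: "v \<in> free_graded a" for v
  proof -
    obtain p where p: "v = (\<Sum>j\<in>UNIV. p j *s ?e j)" using free_graded_as_sum[OF v] by blast
    have "\<phi> v = (\<Sum>j\<in>UNIV. \<phi> (p j *s ?e j))"
      unfolding p using axis_monom_in_free_graded pvec.subspace_scale[OF M]
      by (intro additive_on_sum[OF M add scale]) auto
    also have "\<dots> = (\<Sum>j\<in>UNIV. const_matrix A *v (p j *s ?e j))"
      by (rule sum.cong)
        (simp_all only: scale[rule_format, OF axis_monom_in_free_graded] gen matrix_vector_mult_smult)
    also have "\<dots> = const_matrix A *v v"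
      unfolding p by (simp add: matrix_vector_mult_sum)
    finally show ?thesis .
  qed
  have "x = 0" if x: "A *v x = 0" for x
  proof -
    \<comment> \<open>A common degree in which \<open>free_graded a\<close> is the whole ambient module.\<close>
    define D where "D = Max (range a)"
    define v where "v = (\<chi> j. monom (x $ j) D)"
    have "a j \<le> D" for j unfolding D_def by (rule Max_ge) auto
    then have v: "v \<in> free_graded a"
      by (auto simp: free_graded_def v_def monom_1_dvd_iff') (metis leD)
    have "const_matrix A *v v = (\<chi> i. monom ((A *v x) $ i) D)"
      by (simp add: vec_eq_iff const_matrix_def v_def smult_monom monom_sum
          matrix_vector_mult_def)
    then have "\<phi> v = 0" using \<phi>[OF v] x by (simp add: vec_eq_iff)
    moreover have "\<phi> 0 = 0" using \<phi>[OF pvec.subspace_0[OF M]] by simp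
    ultimately have "v = 0"
      using bij v pvec.subspace_0[OF M] by (metis bij_betw_def inj_onD)
    then show "x = 0" by (simp add: v_def vec_eq_iff)
  qed
  then have "A \<in> carrier GL"
    using matrix_left_invertible_ker[of A] invertible_left_inverse[of A] by (auto simp: GL_def)
  moreover have "K = (*v) (const_matrix A) ` free_graded a"
    using bij \<phi> by (auto simp: bij_betw_def)
  ultimately show ?thesis by blast
qed

lemma const_matrix_image_free_graded:
  assumes "A \<in> carrier GL"
  shows "graded_submodule ((*v) (const_matrix A) ` free_graded a)"
    and "graded_iso ((*v) (const_matrix A) ` free_graded a) (free_graded a)"
proof -
  let ?F = "free_graded a" and ?c = "\<lambda>A v. const_matrix A *v v"
  obtain B where B: "B ** A = mat 1"
    using assms by (auto simp: GL_def invertible_def)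
  have M: "pvec.subspace ?F" and comp: "\<And>v k. v \<in> ?F \<Longrightarrow> hom_component k v \<in> ?F"
    using graded_submodule_free_graded[of a] unfolding graded_submodule_def by auto
  have "pvec.subspace (?c A ` ?F)"
    unfolding pvec.subspace_def
  proof (intro conjI ballI allI)
    show "0 \<in> ?c A ` ?F" using pvec.subspace_0[OF M] by (intro image_eqI[of _ _ 0]) auto
  next
    fix x y assume "x \<in> ?c A ` ?F" "y \<in> ?c A ` ?F"
    then show "x + y \<in> ?c A ` ?F"
      using pvec.subspace_add[OF M] by (auto simp: matrix_vector_right_distrib[symmetric])
  next
    fix p x assume "x \<in> ?c A ` ?F"
    then show "p *s x \<in> ?c A ` ?F"
      using pvec.subspace_scale[OF M] by (auto simp: matrix_vector_mult_smult[symmetric])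
  qed
  then show "graded_submodule (?c A ` ?F)"
    unfolding graded_submodule_def using comp by (auto simp: hom_component_const_matrix)
  show "graded_iso (?c A ` ?F) ?F"
    unfolding graded_iso_def
  proof (intro exI[of _ "?c B"] conjI ballI allI impI)
    show "bij_betw (?c B) (?c A ` ?F) ?F"
      by (rule bij_betwI'; auto simp: const_matrix_mult_inverse[OF B])
    show "homogeneous k (?c B x)" if "homogeneous k x" for k x
      using that by (simp add: homogeneous_def hom_component_const_matrix)
  qed (auto simp: matrix_vector_right_distrib matrix_vector_mult_smult)
qed

lemma graded_iso_free_graded_iff:
  "graded_submodule K \<and> graded_iso K (free_graded a) \<longleftrightarrow>
    K \<in> (\<lambda>A. (*v) (const_matrix A) ` free_graded a) ` carrier GL"
  using graded_iso_free_graded_imp const_matrix_image_free_graded by blast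

lemma free_graded_antimono:
  assumes "\<And>i. a i \<le> c i"
  shows "free_graded c \<subseteq> free_graded a"
  unfolding free_graded_def using assms
  by (auto simp: monom_1_dvd_iff') (meson order_less_le_trans)

lemma const_matrix_image_free_graded_const:
  "(*v) (const_matrix A) ` free_graded (\<lambda>_. m) \<subseteq> free_graded (\<lambda>_. m)"
  by (auto simp: free_graded_def const_matrix_mult_component intro!: dvd_sum dvd_smult)

text \<open>\<open>F0\<close> contains the truncation of the ambient module at any degree bounding the \<open>b i\<close>, since
  that truncation is stable under constant matrices.\<close>

lemma K_set_eq_orbit:
  assumes F0: "graded_submodule F0" "graded_iso F0 (free_graded b)"
    and le: "\<And>i j. b i \<le> d j"
  shows "K_set F0 d = (\<lambda>A. (*v) (const_matrix A) ` free_graded d) ` carrier GL"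
proof -
  obtain A where A: "A \<in> carrier GL" and F0_eq: "F0 = (*v) (const_matrix A) ` free_graded b"
    using graded_iso_free_graded_imp[OF F0] by blast
  obtain B where B: "A ** B = mat 1" using A by (auto simp: GL_def invertible_def)
  let ?m = "Max (range b)"
  have trunc: "free_graded (\<lambda>_. ?m) \<subseteq> F0"
  proof
    fix v :: "complex poly^'a" assume "v \<in> free_graded (\<lambda>_. ?m)"
    then have "const_matrix B *v v \<in> free_graded (\<lambda>_. ?m)"
      using const_matrix_image_free_graded_const by blast
    also have "free_graded (\<lambda>_. ?m) \<subseteq> free_graded b"
      by (intro free_graded_antimono) simp
    finally show "v \<in> F0"
      unfolding F0_eq by (rule image_eqI[rotated]) (simp add: const_matrix_mult_inverse[OF B])
  qed
  have "free_graded d \<subseteq> free_graded (\<lambda>_. ?m)"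
    by (intro free_graded_antimono) (simp add: le)
  then have "(*v) (const_matrix C) ` free_graded d \<subseteq> F0" for C
    using const_matrix_image_free_graded_const[of C ?m] trunc by blast
  then show ?thesis
    unfolding K_set_def using graded_iso_free_graded_iff[of _ d] by blast
qed

section \<open>Stabilisers\<close>

lemma const_matrix_free_graded_subset_iff:
  fixes d :: "'n::{finite,linorder} \<Rightarrow> nat"
  assumes d: "strict_mono d"
  shows "(*v) (const_matrix A) ` free_graded d \<subseteq> free_graded d \<longleftrightarrow> (\<forall>i j. j < i \<longrightarrow> A $ i $ j = 0)"
proof
  assume sub: "(*v) (const_matrix A) ` free_graded d \<subseteq> free_graded d"
  show "\<forall>i j. j < i \<longrightarrow> A $ i $ j = 0"
  proof (intro allI impI)
    fix i j :: 'n assume "j < i"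
    then have less: "d j < d i" using d by (simp add: strict_mono_less)
    have "const_matrix A *v axis j (monom 1 (d j)) \<in> free_graded d"
      using sub axis_monom_in_free_graded by blast
    then have "monom 1 (d i) dvd monom (A $ i $ j) (d j)"
      by (auto simp: free_graded_def matrix_vector_mult_axis const_matrix_def smult_monom)
    then show "A $ i $ j = 0" using less by (auto simp: monom_1_dvd_iff')
  qed
next
  assume upper: "\<forall>i j. j < i \<longrightarrow> A $ i $ j = 0"
  show "(*v) (const_matrix A) ` free_graded d \<subseteq> free_graded d"
  proof (clarsimp simp: free_graded_def const_matrix_mult_component)
    fix v :: "(complex poly, 'n) vec" and i :: 'n
    assume v: "\<forall>i. monom 1 (d i) dvd v $ i"
    have "monom 1 (d i) dvd smult (A $ i $ j) (v $ j)" for j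
    proof (cases "j < i")
      case False
      then have "d i \<le> d j" using d by (simp add: strict_mono_less_eq)
      then have "monom 1 (d i) dvd (monom 1 (d j) :: complex poly)"
        by (auto simp: monom_1_dvd_iff')
      then show ?thesis using v dvd_trans dvd_smult by blast
    qed (use upper in simp)
    then show "monom 1 (d i) dvd (\<Sum>j\<in>UNIV. smult (A $ i $ j) (v $ j))"
      by (rule dvd_sum)
  qed
qed

lemma Borel_subgroup_eq_flag_stabiliser:
  "Borel_subgroup = {A \<in> carrier GL. flag_of A = flag_of \<one>\<^bsub>GL\<^esub>}"
  unfolding Borel_subgroup_def
  by (rule Collect_cong, rule conj_cong[OF refl], subst flag_of_eq_iff_upper_triangular[symmetric])
    (simp_all add: GL_def)

lemma flag_of_mult: "flag_of (A ** B) = map ((`) ((*v) A)) (flag_of B)"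
  by (simp add: flag_of_def image_image matrix_vector_mul_assoc comp_def del: upt_Suc)

text \<open>Upper triangularity of the inverse, which is needed for the stabiliser of \<open>free_graded d\<close>
  to be all of the Borel subgroup, is read off from the flag description.\<close>

lemma Borel_subgroup_eq_free_graded_stabiliser:
  fixes d :: "'n::{finite,linorder} \<Rightarrow> nat"
  assumes d: "strict_mono d"
  shows "Borel_subgroup = {A \<in> carrier GL.
    (*v) (const_matrix A) ` free_graded d = (*v) (const_matrix \<one>\<^bsub>GL\<^esub>) ` free_graded d}"
proof (intro equalityI subsetI)
  fix A :: "((complex, 'n) vec, 'n) vec"
  assume A: "A \<in> Borel_subgroup"
  then have GL: "A \<in> carrier GL" by (simp add: Borel_subgroup_def)
  then obtain B where AB: "A ** B = mat 1" and BA: "B ** A = mat 1"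
    by (auto simp: GL_def invertible_def)
  have B: "B \<in> carrier GL" using AB BA by (auto simp: GL_def invertible_def)
  have "flag_of A = flag_of (mat 1)"
    using A unfolding Borel_subgroup_eq_flag_stabiliser by (simp add: GL_def)
  then have "flag_of (B ** A) = flag_of (B ** mat 1)"
    unfolding flag_of_mult by simp
  then have "flag_of B = flag_of (mat 1)" by (simp add: BA)
  then have "(*v) (const_matrix B) ` free_graded d \<subseteq> free_graded d"
    using flag_of_eq_iff_upper_triangular[OF B] const_matrix_free_graded_subset_iff[OF d] by blast
  then have "free_graded d \<subseteq> (*v) (const_matrix A) ` free_graded d"
    using const_matrix_mult_inverse[OF AB] by (metis image_subset_iff image_eqI subsetI)
  moreover have "(*v) (const_matrix A) ` free_graded d \<subseteq> free_graded d"
    using A const_matrix_free_graded_subset_iff[OF d] by (simp add: Borel_subgroup_def)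
  ultimately show "A \<in> {A \<in> carrier GL.
      (*v) (const_matrix A) ` free_graded d = (*v) (const_matrix \<one>\<^bsub>GL\<^esub>) ` free_graded d}"
    using GL by (auto simp: GL_def const_matrix_mat_1)
next
  fix A :: "((complex, 'n) vec, 'n) vec"
  assume "A \<in> {A \<in> carrier GL.
      (*v) (const_matrix A) ` free_graded d = (*v) (const_matrix \<one>\<^bsub>GL\<^esub>) ` free_graded d}"
  then show "A \<in> Borel_subgroup"
    using const_matrix_free_graded_subset_iff[OF d, of A]
    by (simp add: Borel_subgroup_def GL_def const_matrix_mat_1)
qed

section \<open>The bijections\<close>

theorem mainTheorem2:
  fixes b d :: "'n::{finite,linorder} \<Rightarrow> nat"
    and F0 :: "(complex poly^('n::{finite,linorder})) set"
  assumes "strict_mono b"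
    and "strict_mono d"
    and "b (Max UNIV) < d (Min UNIV)"
    and "graded_submodule F0"
    and "graded_iso F0 (free_graded b)"
  shows "\<exists>\<Phi> \<Psi>.
    bij_betw \<Phi> (K_set F0 d) (lcosets\<^bsub>GL\<^esub> (Borel_subgroup :: (complex^('n::{finite,linorder})^('n::{finite,linorder})) set)) \<and>
    bij_betw \<Psi> (lcosets\<^bsub>GL\<^esub> (Borel_subgroup :: (complex^('n::{finite,linorder})^('n::{finite,linorder})) set))
      (complete_flags :: (complex^('n::{finite,linorder})) set list set)"
proof -
  interpret GL: group "GL :: (((complex, 'n) vec, 'n) vec) monoid" by (rule group_GL)
  let ?B = "Borel_subgroup :: ((complex, 'n) vec, 'n) vec set"
  have le: "b i \<le> d j" for i j
  proof -
    have "b i \<le> b (Max UNIV)" "d (Min UNIV) \<le> d j"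
      using assms(1,2) by (simp_all add: strict_mono_less_eq)
    then show ?thesis using assms(3) by linarith
  qed
  have "\<exists>g. bij_betw g (lcosets\<^bsub>GL\<^esub> ?B) (K_set F0 d)"
  proof (rule GL.orbit_lcosets_bij[where f = "\<lambda>A :: ((complex, 'n) vec, 'n) vec. (*v) (const_matrix A) ` free_graded d"])
    fix A B C :: "((complex, 'n) vec, 'n) vec"
    assume "(*v) (const_matrix A) ` free_graded d = (*v) (const_matrix B) ` free_graded d"
    then have "(*v) (const_matrix C) ` (*v) (const_matrix A) ` free_graded d
        = (*v) (const_matrix C) ` (*v) (const_matrix B) ` free_graded d" by simp
    then show "(*v) (const_matrix (C \<otimes>\<^bsub>GL\<^esub> A)) ` free_graded d
        = (*v) (const_matrix (C \<otimes>\<^bsub>GL\<^esub> B)) ` free_graded d"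
      by (simp add: GL_def image_image const_matrix_mult matrix_vector_mul_assoc)
  qed (use Borel_subgroup_eq_free_graded_stabiliser[OF assms(2)]
      K_set_eq_orbit[OF assms(4,5) le] in simp_all)
  then obtain g where "bij_betw g (lcosets\<^bsub>GL\<^esub> ?B) (K_set F0 d)" by blast
  then have \<Phi>: "bij_betw (inv_into (lcosets\<^bsub>GL\<^esub> ?B) g)
      (K_set F0 d) (lcosets\<^bsub>GL\<^esub> ?B)"
    by (rule bij_betw_inv_into)
  have "\<exists>\<Psi>. bij_betw \<Psi> (lcosets\<^bsub>GL\<^esub> ?B) (complete_flags :: ((complex, 'n) vec) set list set)"
  proof (rule GL.orbit_lcosets_bij[where f = flag_of])
    show "flag_of ` carrier GL = (complete_flags :: ((complex, 'n) vec) set list set)"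
      using flag_of_in_complete_flags complete_flag_is_flag_of by blast
  qed (use Borel_subgroup_eq_flag_stabiliser in \<open>simp_all add: GL_def flag_of_mult\<close>)
  with \<Phi> show ?thesis by blast
qed

end
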